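(* Let $c\in\mathfrak S_n$ be an iterable cobigrassmannian permutation with quadruple $(n_0,n_1,n_2,n_3)$ and iterate $c^1$, and let $w\in\mathfrak S_n$ be such that $w\le c$ and $w\not\le c^1$. Then the permutations $\tau_{(P_+,P_-)}$, for $(P_+,P_-)\in\partial(NO_w)\times\partial(SE_w)$, are exactly the maximal elements (for the Bruhat order) of $\Lambda(w,c^1)=\{z\in\mathfrak S_n : z\le w\text{ and } z\le c^1\}$.
   Context: $\le$ is the Bruhat-Chevalley order on $\mathfrak S_n$. For $n_0,n_3\in\mathbb N$, $n_1,n_2\ge1$ with $n_0+n_1+n_2+n_3=n$, the cobigrassmannian with quadruple $(n_0,n_1,n_2,n_3)$ is the permutation with one-line notation obtained by writing successively the four decreasing blocks: $n,\dots,n-n_0+1$ ($n_0$ values); $n_1+n_3,\dots,n_3+1$ ($n_1$ values); $n_1+n_2+n_3,\dots,n_1+n_3+1$ ($n_2$ values); $n_3,\dots,1$ ($n_3$ values). It is iterable if $n_0,n_3\ge1$, and then its iterate $c^1$ is the permutation defined in the same way by the quadruple $(n_0-1,n_1+1,n_2+1,n_3-1)$. Put $p=n_0+n_1$, $q=n_1+n_3$. $\Gamma_w=\{(x,w(x))\}$ is the graph of $w$, and $NO_w=\{(x,y)\in\Gamma_w: x\le p,\ y>q\}$, $SO_w=\{(x,y)\in\Gamma_w: x\le p,\ y\le q\}$, $NE_w=\{(x,y)\in\Gamma_w: x>p,\ y>q\}$, $SE_w=\{(x,y)\in\Gamma_w: x>p,\ y\le q\}$. $\partial(NO_w)$ is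 the set of points $(x,y)\in NO_w$ such that no other point $(x',y')\in NO_w$ satisfies $x'>x$, $y'<y$; $\partial(SE_w)$ is the set of points $(x,y)\in SE_w$ such that no other point $(x',y')\in SE_w$ satisfies $x'<x$, $y'>y$. Given $P_+=(x_\infty,y_\infty)\in\partial(NO_w)$ and $P_-=(x_{-\infty},y_{-\infty})\in\partial(SE_w)$, let $\mathcal R=\,]x_\infty,x_{-\infty}[\,\times\,]y_{-\infty},y_\infty[$. Let $(x_i,y_i)_{1\le i\le s}$ ($s\ge0$) be the South-West boundary of $NE_w\cap\mathcal R$ (points of this set having no other point of this set with both coordinates smaller), indexed so that $x_s<\cdots<x_1$, hence $y_1<\cdots<y_s$. Let $(x_i,y_i)_{-t\le i\le-1}$ ($t\ge0$) be the North-East boundary of $SO_w\cap\mathcal R$ (points having no other point of this set with both coordinates larger), indexed so that $x_{-1}<\cdots<x_{-t}$, hence $y_{-t}<\cdots<y_{-1}$. Let $\gamma_{(P_+,P_-)}$ be the cycle $(y_\infty,y_{-1},\dots,y_{-t},y_{-\infty},y_1,\dots,y_s)$ (each entry is sent to the next one, the last to the first), and $\tau_{(P_+,P_-)}=\gamma_{(P_+,P_-)}\,w$ (composition). *)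

theory Defs
  imports "HOL-Combinatorics.Combinatorics"
begin

text \<open>
  Elements of the symmetric group of degree n are functions w on nat with w permutes {1..n}; they
  fix every number outside {1..n}, so equality of functions is equality of permutations.
\<close>

definition perm_length :: "nat \<Rightarrow> (nat \<Rightarrow> nat) \<Rightarrow> nat" where
  "perm_length n w = card {(i, j). 1 \<le> i \<and> i < j \<and> j \<le> n \<and> w j < w i}"

definition bruhat_step :: "nat \<Rightarrow> (nat \<Rightarrow> nat) \<Rightarrow> (nat \<Rightarrow> nat) \<Rightarrow> bool" where
  "bruhat_step n u v \<longleftrightarrow>
     (\<exists>i j. 1 \<le> i \<and> i < j \<and> j \<le> n \<and> v = u \<circ> transpose i j \<and> perm_length n u < perm_length n v)"

definition bruhat_le :: "nat \<Rightarrow> (nat \<Rightarrow> nat) \<Rightarrow> (nat \<Rightarrow> nat) \<Rightarrow> bool" where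
  "bruhat_le n u v \<longleftrightarrow> u permutes {1..n} \<and> v permutes {1..n} \<and> (bruhat_step n)\<^sup>*\<^sup>* u v"

definition bruhat_maximal :: "nat \<Rightarrow> (nat \<Rightarrow> nat) set \<Rightarrow> (nat \<Rightarrow> nat) set" where
  "bruhat_maximal n Z = {z \<in> Z. \<forall>z' \<in> Z. bruhat_le n z z' \<longrightarrow> z' = z}"

definition Lambda :: "nat \<Rightarrow> (nat \<Rightarrow> nat) \<Rightarrow> (nat \<Rightarrow> nat) \<Rightarrow> (nat \<Rightarrow> nat) set" where
  "Lambda n u v = {z. z permutes {1..n} \<and> bruhat_le n z u \<and> bruhat_le n z v}"

definition cobigrassmannian_word :: "nat \<Rightarrow> nat \<Rightarrow> nat \<Rightarrow> nat \<Rightarrow> nat list" where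
  "cobigrassmannian_word n\<^sub>0 n\<^sub>1 n\<^sub>2 n\<^sub>3 =
     rev [n\<^sub>1 + n\<^sub>2 + n\<^sub>3 + 1 ..< n\<^sub>0 + n\<^sub>1 + n\<^sub>2 + n\<^sub>3 + 1] @
     rev [n\<^sub>3 + 1 ..< n\<^sub>1 + n\<^sub>3 + 1] @
     rev [n\<^sub>1 + n\<^sub>3 + 1 ..< n\<^sub>1 + n\<^sub>2 + n\<^sub>3 + 1] @
     rev [1 ..< n\<^sub>3 + 1]"

definition cobigrassmannian :: "nat \<Rightarrow> nat \<Rightarrow> nat \<Rightarrow> nat \<Rightarrow> nat \<Rightarrow> nat" where
  "cobigrassmannian n\<^sub>0 n\<^sub>1 n\<^sub>2 n\<^sub>3 x =
     (if x \<in> {1..n\<^sub>0 + n\<^sub>1 + n\<^sub>2 + n\<^sub>3} then cobigrassmannian_word n\<^sub>0 n\<^sub>1 n\<^sub>2 n\<^sub>3 ! (x - 1) else x)"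

definition perm_graph :: "nat \<Rightarrow> (nat \<Rightarrow> nat) \<Rightarrow> (nat \<times> nat) set" where
  "perm_graph n w = {(x, w x) | x. x \<in> {1..n}}"

definition NO :: "nat \<Rightarrow> nat \<Rightarrow> nat \<Rightarrow> (nat \<Rightarrow> nat) \<Rightarrow> (nat \<times> nat) set" where
  "NO n p q w = {(x, y) \<in> perm_graph n w. x \<le> p \<and> y > q}"

definition SO :: "nat \<Rightarrow> nat \<Rightarrow> nat \<Rightarrow> (nat \<Rightarrow> nat) \<Rightarrow> (nat \<times> nat) set" where
  "SO n p q w = {(x, y) \<in> perm_graph n w. x \<le> p \<and> y \<le> q}"

definition NE :: "nat \<Rightarrow> nat \<Rightarrow> nat \<Rightarrow> (nat \<Rightarrow> nat) \<Rightarrow> (nat \<times> nat) set" where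
  "NE n p q w = {(x, y) \<in> perm_graph n w. x > p \<and> y > q}"

definition SE :: "nat \<Rightarrow> nat \<Rightarrow> nat \<Rightarrow> (nat \<Rightarrow> nat) \<Rightarrow> (nat \<times> nat) set" where
  "SE n p q w = {(x, y) \<in> perm_graph n w. x > p \<and> y \<le> q}"

definition boundary_NO :: "nat \<Rightarrow> nat \<Rightarrow> nat \<Rightarrow> (nat \<Rightarrow> nat) \<Rightarrow> (nat \<times> nat) set" where
  "boundary_NO n p q w =
     {(x, y) \<in> NO n p q w. \<not> (\<exists>(x', y') \<in> NO n p q w. x' > x \<and> y' < y)}"

definition boundary_SE :: "nat \<Rightarrow> nat \<Rightarrow> nat \<Rightarrow> (nat \<Rightarrow> nat) \<Rightarrow> (nat \<times> nat) set" where
  "boundary_SE n p q w =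
     {(x, y) \<in> SE n p q w. \<not> (\<exists>(x', y') \<in> SE n p q w. x' < x \<and> y' > y)}"

definition SW_boundary :: "(nat \<times> nat) set \<Rightarrow> (nat \<times> nat) set" where
  "SW_boundary A = {(x, y) \<in> A. \<not> (\<exists>(x', y') \<in> A. x' < x \<and> y' < y)}"

definition NE_boundary :: "(nat \<times> nat) set \<Rightarrow> (nat \<times> nat) set" where
  "NE_boundary A = {(x, y) \<in> A. \<not> (\<exists>(x', y') \<in> A. x' > x \<and> y' > y)}"

text \<open>Below, P stands for the point with index +infinity and Q for the one with index -infinity.\<close>

definition open_rect :: "nat \<times> nat \<Rightarrow> nat \<times> nat \<Rightarrow> (nat \<times> nat) set" where
  "open_rect P Q = {fst P <..< fst Q} \<times> {snd Q <..< snd P}"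

text \<open>
  Both boundaries are listed by their abscissas: increasingly for the indices -1, ..., -t, and
  decreasingly for the indices 1, ..., s. The ordinate of the point of the graph of w over x is w x.
\<close>

definition gamma_entries ::
  "nat \<Rightarrow> nat \<Rightarrow> nat \<Rightarrow> (nat \<Rightarrow> nat) \<Rightarrow> nat \<times> nat \<Rightarrow> nat \<times> nat \<Rightarrow> nat list" where
  "gamma_entries n p q w P Q =
     [snd P] @
     map w (sorted_list_of_set (fst ` NE_boundary (SO n p q w \<inter> open_rect P Q))) @
     [snd Q] @
     map w (rev (sorted_list_of_set (fst ` SW_boundary (NE n p q w \<inter> open_rect P Q))))"

text \<open>
  On a list of distinct entries, the library function for cycles sends each entry to the next one
  and the last entry to the first.
\<close>

definition tau ::
  "nat \<Rightarrow> nat \<Rightarrow> nat \<Rightarrow> (nat \<Rightarrow> nat) \<Rightarrow> nat \<times> nat \<Rightarrow> nat \<times> nat \<Rightarrow> nat \<Rightarrow> nat" where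
  "tau n p q w P Q = cycle_of_list (gamma_entries n p q w P Q) \<circ> w"

end

theory Submission
  imports Defs
begin

text \<open>
  Write \<open>r u (i, j)\<close> for the number of points of the graph of \<open>u\<close> with abscissa at most \<open>i\<close> and
  ordinate greater than \<open>j\<close>. The Bruhat order is the pointwise order on these rank functions, and
  lying below a cobigrassmannian permutation is a single inequality at \<open>(p, q)\<close>. Hence the
  hypothesis says that \<open>r w (p, q) = n\<^sub>0\<close>, and \<open>Lambda\<close> consists of the \<open>z \<le> w\<close> whose rank at
  \<open>(p, q)\<close> is smaller than that of \<open>w\<close>.

  The rank function of \<open>tau\<close> is that of \<open>w\<close> minus the indicator of the region enclosed between the
  two staircases, which contains \<open>(p, q)\<close>. So \<open>tau\<close> belongs to \<open>Lambda\<close>, and since its region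
  determines the pair of points, different pairs give incomparable permutations.

  Conversely let \<open>z\<close> be in \<open>Lambda\<close>. A Bruhat step changes ranks by at most one, so \<open>z\<close> may be
  replaced by a larger element whose rank at \<open>(p, q)\<close> is \<open>n\<^sub>0 - 1\<close>. Following a chain from \<open>z\<close> up
  to \<open>w\<close> produces a point of \<open>NO\<close> and a point of \<open>SE\<close> such that \<open>r z < r w\<close> on the rectangles they
  span with \<open>(p, q)\<close>. The points can be moved to the boundaries, and inclusion-exclusion extends
  the strict inequality to the whole region, which means that \<open>z \<le> tau\<close>.
\<close>

section \<open>Rank functions\<close>

text \<open>Values are integers so that ranks can be subtracted; summing over abscissas makes the
  passage to the next column a recursion.\<close>

definition rank_NW :: "(nat \<Rightarrow> nat) \<Rightarrow> nat \<Rightarrow> nat \<Rightarrow> int" where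
  "rank_NW u i j = (\<Sum>a = 1..i. of_bool (j < u a))"

lemma rank_NW_0 [simp]: "rank_NW u 0 j = 0"
  by (simp add: rank_NW_def)

lemma rank_NW_Suc: "rank_NW u (Suc i) j = rank_NW u i j + of_bool (j < u (Suc i))"
  by (simp add: rank_NW_def)

lemma rank_NW_split:
  assumes "i \<le> i'"
  shows "rank_NW u i' j = rank_NW u i j + (\<Sum>a = Suc i..i'. of_bool (j < u a))"
  using assms by (induction i' rule: dec_induct) (auto simp: rank_NW_Suc)

text \<open>A column holds at most one point, and adding columns never removes points; truncated
  subtraction covers both directions in one bound.\<close>

lemma rank_NW_le_add_columns: "rank_NW u i j \<le> rank_NW u i' j + int (i - i')"
proof (cases "i' \<le> i")
  case True
  have "(\<Sum>a = Suc i'..i. of_bool (j < u a) :: int) \<le> (\<Sum>a = Suc i'..i. 1)"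
    by (intro sum_mono) auto
  then show ?thesis
    using rank_NW_split[OF True, of u j] True by simp
next
  case False
  have "(\<Sum>a = Suc i..i'. of_bool (j < u a) :: int) \<ge> 0"
    by (intro sum_nonneg) auto
  then show ?thesis
    using rank_NW_split[of i i' u j] False by simp
qed

lemma rank_NW_le_add_rows:
  assumes "inj u"
  shows "rank_NW u i j \<le> rank_NW u i j' + int (j' - j)"
proof -
  let ?A = "{a \<in> {1..i}. j < u a \<and> u a \<le> j'}"
  have "rank_NW u i j \<le> (\<Sum>a = 1..i. of_bool (j' < u a) + of_bool (j < u a \<and> u a \<le> j'))"
    unfolding rank_NW_def by (intro sum_mono) auto
  also have "\<dots> = rank_NW u i j' + int (card ?A)"
    by (simp add: rank_NW_def sum.distrib flip: sum.inter_filter) (simp add: Int_def)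
  also have "card ?A \<le> card {j<..j'}"
    by (rule card_inj_on_le[where f = u]) (auto intro: inj_on_subset[OF assms])
  finally show ?thesis
    by simp
qed

lemma rank_NW_le_columns: "rank_NW u i j \<le> int i"
  using rank_NW_le_add_columns[of u i j 0] by simp

lemma rank_NW_le_rows:
  assumes "u permutes {1..n}" and "i \<le> n"
  shows "rank_NW u i j \<le> int (n - j)"
proof -
  have "u a \<le> n" if "a \<in> {1..i}" for a
    using permutes_in_image[OF assms(1), of a] that assms(2) by auto
  then have "rank_NW u i n = 0"
    unfolding rank_NW_def by (intro sum.neutral) (auto simp: not_less)
  then show ?thesis
    using rank_NW_le_add_rows[OF permutes_inj[OF assms(1)], of i j n] by simp
qed

text \<open>Consecutive columns reveal whether \<open>j < u x\<close> for every row
  \<open>j\<close>; the rows \<open>j = u x\<close> and \<open>j = v x\<close> then force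
  equality.\<close>

lemma rank_NW_eq_imp_eq:
  assumes u: "u permutes {1..n}" and v: "v permutes {1..n}"
    and eq: "\<And>i j. i \<le> n \<Longrightarrow> j \<le> n \<Longrightarrow> rank_NW u i j = rank_NW v i j"
  shows "u = v"
proof
  fix x
  show "u x = v x"
  proof (cases "x \<in> {1..n}")
    case True
    then obtain i where i: "x = Suc i" "Suc i \<le> n"
      by (cases x) auto
    have le: "u x \<le> n" "v x \<le> n"
      using permutes_in_image[OF u, of x] permutes_in_image[OF v, of x] True by auto
    have "of_bool (j < u x) = (of_bool (j < v x) :: int)" if "j \<le> n" for j
      using eq[of i j] eq[of "Suc i" j] that i by (simp add: rank_NW_Suc)
    from this[OF le(1)] this[OF le(2)] show ?thesis
      by (auto simp: of_bool_def split: if_splits)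
  next
    case False
    then show ?thesis
      using permutes_not_in[OF u] permutes_not_in[OF v] by simp
  qed
qed

text \<open>A prefix of columns containing both or neither of \<open>a\<close> and \<open>b\<close>
  keeps its set of values; one containing only \<open>a\<close> trades \<open>u a\<close> for
  \<open>u b\<close>.\<close>

lemma rank_NW_transpose:
  assumes "1 \<le> a" "a < b" "u a < u b"
  shows "rank_NW (u \<circ> transpose a b) i j =
    rank_NW u i j + of_bool (a \<le> i \<and> i < b \<and> u a \<le> j \<and> j < u b)"
proof (induction i)
  case 0
  then show ?case using assms by simp
next
  case (Suc i)
  consider "Suc i = a" | "Suc i = b" | "Suc i \<noteq> a" "Suc i \<noteq> b" by blast
  then show ?case
  proof cases
    case 1
    then show ?thesis using Suc assms by (auto simp: rank_NW_Suc)
  next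
    case 2
    then show ?thesis using Suc assms by (auto simp: rank_NW_Suc)
  next
    case 3
    then have "transpose a b (Suc i) = Suc i"
      by simp
    then show ?thesis using Suc 3 by (auto simp: rank_NW_Suc)
  qed
qed

section \<open>The rank criterion for the Bruhat order\<close>

lemma perm_length_transpose_less:
  assumes "1 \<le> a" "a < b" "b \<le> n" "u a < u b"
  shows "perm_length n u < perm_length n (u \<circ> transpose a b)"
proof -
  let ?t = "transpose a b"
  define Inv where "Inv v = {(i, j). 1 \<le> i \<and> i < j \<and> j \<le> n \<and> v j < v i}" for v :: "nat \<Rightarrow> nat"
  \<comment> \<open>An inversion is carried along by the transposition; if this would reverse the
    pair, the pair itself is kept and remains an inversion because \<open>u a < u b\<close>. The new
    inversion \<open>(a, b)\<close> is missed.\<close>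
  define f where "f = (\<lambda>(i, j). if ?t i < ?t j then (?t i, ?t j) else (i, j))"
  have fin: "finite (Inv v)" for v
    by (rule finite_subset[of _ "{1..n} \<times> {1..n}"]) (auto simp: Inv_def)
  have mem: "(a, b) \<in> Inv (u \<circ> ?t)"
    using assms by (auto simp: Inv_def)
  have inj: "inj_on f (Inv u)"
  proof (rule inj_onI)
    fix x y assume xy: "x \<in> Inv u" "y \<in> Inv u" "f x = f y"
    obtain i j i' j' where "x = (i, j)" "y = (i', j')"
      by (cases x, cases y)
    with xy show "x = y"
      by (auto simp: f_def Inv_def split: if_splits dest: transpose_eq_imp_eq)
  qed
  have img: "f x \<in> Inv (u \<circ> ?t) - {(a, b)}" if "x \<in> Inv u" for x
  proof -
    obtain i j where x: "x = (i, j)" by (cases x)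
    then have ij: "1 \<le> i" "i < j" "j \<le> n" "u j < u i"
      using that by (auto simp: Inv_def)
    have "?t i \<in> {1..n}" "?t j \<in> {1..n}"
      using ij assms by (auto simp: transpose_def)
    then show ?thesis
      using ij assms by (auto simp: x f_def Inv_def transpose_def split: if_splits)
  qed
  have "card (Inv u) \<le> card (Inv (u \<circ> ?t) - {(a, b)})"
    by (rule card_inj_on_le[OF inj image_subsetI[OF img] finite_Diff[OF fin]])
  also have "\<dots> < card (Inv (u \<circ> ?t))"
    using fin mem by (rule card_Diff1_less)
  finally show ?thesis
    by (simp add: perm_length_def Inv_def)
qed

lemma perm_length_le: "perm_length n u \<le> n * n"
proof -
  have "perm_length n u \<le> card ({1..n} \<times> {1..n})"
    unfolding perm_length_def by (rule card_mono) auto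
  then show ?thesis by simp
qed

text \<open>If \<open>u b < u a\<close>, swapping back leads from \<open>v\<close> up to
  \<open>u\<close> and increases the length, against the length condition.\<close>

lemma bruhat_step_iff:
  assumes "inj u"
  shows "bruhat_step n u v \<longleftrightarrow>
    (\<exists>a b. 1 \<le> a \<and> a < b \<and> b \<le> n \<and> v = u \<circ> transpose a b \<and> u a < u b)"
proof
  assume "bruhat_step n u v"
  then obtain a b where ab: "1 \<le> a" "a < b" "b \<le> n" "v = u \<circ> transpose a b"
    and len: "perm_length n u < perm_length n v"
    unfolding bruhat_step_def by blast
  have "u a < u b"
  proof (rule ccontr)
    assume "\<not> u a < u b"
    moreover have "u a \<noteq> u b"
      using assms ab(2) by (simp add: inj_eq)
    ultimately have "v a < v b"
      by (simp add: ab(4))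
    then have "perm_length n v < perm_length n (v \<circ> transpose a b)"
      using ab by (intro perm_length_transpose_less)
    moreover have "v \<circ> transpose a b = u"
      by (simp add: ab(4) comp_assoc)
    ultimately show False
      using len by simp
  qed
  with ab show "\<exists>a b. 1 \<le> a \<and> a < b \<and> b \<le> n \<and> v = u \<circ> transpose a b \<and> u a < u b"
    by blast
next
  assume "\<exists>a b. 1 \<le> a \<and> a < b \<and> b \<le> n \<and> v = u \<circ> transpose a b \<and> u a < u b"
  then show "bruhat_step n u v"
    unfolding bruhat_step_def using perm_length_transpose_less by blast
qed

lemma bruhat_stepE:
  assumes "bruhat_step n u v" and "u permutes {1..n}"
  obtains a b where "1 \<le> a" "a < b" "b \<le> n" "v = u \<circ> transpose a b" "u a < u b"
    "\<And>i j. rank_NW v i j = rank_NW u i j + of_bool (a \<le> i \<and> i < b \<and> u a \<le> j \<and> j < u b)"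
proof -
  obtain a b where "1 \<le> a" "a < b" "b \<le> n" "v = u \<circ> transpose a b" "u a < u b"
    using assms(1) unfolding bruhat_step_iff[OF permutes_inj[OF assms(2)]] by blast
  with rank_NW_transpose[of a b u] show ?thesis
    by (intro that) auto
qed

lemma bruhat_step_permutes:
  assumes "bruhat_step n u v" and "u permutes {1..n}"
  shows "v permutes {1..n}"
  using assms unfolding bruhat_step_def
  by (auto intro!: permutes_compose permutes_swap_id)

lemma bruhat_steps_permutes:
  assumes "(bruhat_step n)\<^sup>*\<^sup>* u v" and "u permutes {1..n}"
  shows "v permutes {1..n}"
  using assms by (induction rule: rtranclp_induct) (blast intro: bruhat_step_permutes)+

lemma bruhat_step_rank_mono:
  assumes "bruhat_step n u v" and "u permutes {1..n}"
  shows "rank_NW u i j \<le> rank_NW v i j" "rank_NW v i j \<le> rank_NW u i j + 1"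
  by (rule bruhat_stepE[OF assms], simp)+

lemma bruhat_steps_rank_mono:
  assumes "(bruhat_step n)\<^sup>*\<^sup>* u v" and "u permutes {1..n}"
  shows "rank_NW u i j \<le> rank_NW v i j"
  using assms
proof (induction rule: rtranclp_induct)
  case (step y z)
  then show ?case
    using bruhat_step_rank_mono(1)[of n y z i j] bruhat_steps_permutes[of n u y] by simp
qed simp

text \<open>
  The witness transposes the first position where the permutations differ with the first later
  position whose value still fits below the target.
\<close>

lemma rank_le_imp_bruhat_step:
  assumes u: "u permutes {1..n}" and v: "v permutes {1..n}" and "u \<noteq> v"
    and le: "\<And>i j. i \<le> n \<Longrightarrow> j \<le> n \<Longrightarrow> rank_NW u i j \<le> rank_NW v i j"
  obtains u' where "bruhat_step n u u'"
    "\<And>i j. i \<le> n \<Longrightarrow> j \<le> n \<Longrightarrow> rank_NW u' i j \<le> rank_NW v i j"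
proof -
  obtain x where "u x \<noteq> v x"
    using \<open>u \<noteq> v\<close> by blast
  define a where "a = (LEAST x. u x \<noteq> v x)"
  have a: "u a \<noteq> v a"
    unfolding a_def by (rule LeastI) fact
  have before: "u x = v x" if "x < a" for x
    using not_less_Least[of x "\<lambda>x. u x \<noteq> v x"] that unfolding a_def by blast
  have an: "a \<in> {1..n}"
    using a permutes_not_in[OF u, of a] permutes_not_in[OF v, of a] by metis
  then obtain a' where a': "a = Suc a'"
    by (cases a) auto
  have bnd: "u x \<in> {1..n}" "v x \<in> {1..n}" if "x \<in> {1..n}" for x
    using that permutes_in_image[OF u] permutes_in_image[OF v] by auto
  \<comment> \<open>Agreement before \<open>a\<close> reduces the rank inequality in column
    \<open>a\<close> and row \<open>v a\<close> to the single values there, so \<open>u a\<close>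
    cannot exceed \<open>v a\<close>.\<close>
  have "rank_NW u a' (v a) = rank_NW v a' (v a)"
    unfolding rank_NW_def using before by (intro sum.cong) (auto simp: a')
  moreover have "rank_NW u a (v a) \<le> rank_NW v a (v a)"
    using le an bnd by simp
  ultimately have "u a < v a"
    using a by (auto simp: a' rank_NW_Suc of_bool_def split: if_splits)
  define B where "B k \<longleftrightarrow> a < k \<and> u a < u k \<and> u k \<le> v a" for k
  obtain k0 where k0: "u k0 = v a"
    using permutes_surj[OF u] by (metis surjD)
  have "k0 \<noteq> a" using k0 a by auto
  moreover have "\<not> k0 < a"
  proof
    assume "k0 < a"
    then have "v k0 = v a" using before k0 by simp
    then show False using \<open>k0 < a\<close> permutes_inj[OF v] by (simp add: inj_eq)
  qed
  ultimately have "B k0"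
    using k0 \<open>u a < v a\<close> by (simp add: B_def)
  define b where "b = (LEAST k. B k)"
  have b: "a < b" "u a < u b" "u b \<le> v a"
    using LeastI[of B, OF \<open>B k0\<close>] unfolding b_def[symmetric] by (auto simp: B_def)
  have gap: "\<not> (u a < u x \<and> u x \<le> v a)" if "a < x" "x < b" for x
    using not_less_Least[of x B] that unfolding b_def[symmetric] by (auto simp: B_def)
  have bn: "b \<le> n"
  proof (rule ccontr)
    assume "\<not> b \<le> n"
    then have "u b = b" using permutes_not_in[OF u] by simp
    then show False using b(3) bnd(2)[OF an] \<open>\<not> b \<le> n\<close> by simp
  qed
  let ?u' = "u \<circ> transpose a b"
  \<comment> \<open>Rows above \<open>v a\<close> are covered by the hypothesis. In the rows from
    \<open>j + 1\<close> to \<open>v a\<close>, columns strictly between \<open>a\<close> and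
    \<open>b\<close> hold no point of \<open>u\<close>, and column \<open>a\<close> holds a point of
    \<open>v\<close> only.\<close>
  have strict: "rank_NW u i j < rank_NW v i j" if ij: "a \<le> i" "i < b" "u a \<le> j" "j < u b" for i j
  proof -
    let ?g = "\<lambda>z x. of_bool (j < z x \<and> z x \<le> v a) :: int"
    have split: "rank_NW z i j = rank_NW z i (v a) + (\<Sum>x = 1..i. ?g z x)" for z
      unfolding rank_NW_def sum.distrib[symmetric] using ij b by (intro sum.cong) auto
    have "(\<Sum>x = 1..i. ?g u x) < (\<Sum>x = 1..i. ?g v x)"
    proof (rule sum_strict_mono_ex1)
      show "\<forall>x\<in>{1..i}. ?g u x \<le> ?g v x"
      proof
        fix x assume x: "x \<in> {1..i}"
        consider "x < a" | "x = a" | "a < x" by linarith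
        then show "?g u x \<le> ?g v x"
        proof cases
          case 3
          then show ?thesis using gap[of x] x ij by auto
        qed (use before ij in auto)
      qed
      show "\<exists>x\<in>{1..i}. ?g u x < ?g v x"
        using ij b an by (intro bexI[of _ a]) auto
    qed simp
    moreover have "rank_NW u i (v a) \<le> rank_NW v i (v a)"
      using le ij bn bnd(2)[OF an] by simp
    ultimately show ?thesis
      using split[of u] split[of v] by simp
  qed
  show ?thesis
  proof
    show "bruhat_step n u ?u'"
      using an b bn by (auto simp: bruhat_step_iff[OF permutes_inj[OF u]])
    show "rank_NW ?u' i j \<le> rank_NW v i j" if "i \<le> n" "j \<le> n" for i j
      using le[OF that] strict[of i j] rank_NW_transpose[of a b u i j] an b by auto
  qed
qed

text \<open>Each step supplied by the preceding lemma raises the length, which is at most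
  \<open>n * n\<close>, so the chain must reach \<open>v\<close>.\<close>

lemma rank_le_imp_bruhat_steps:
  assumes "u permutes {1..n}" and v: "v permutes {1..n}"
    and "\<And>i j. i \<le> n \<Longrightarrow> j \<le> n \<Longrightarrow> rank_NW u i j \<le> rank_NW v i j"
  shows "(bruhat_step n)\<^sup>*\<^sup>* u v"
  using assms(1,3)
proof (induction "n * n - perm_length n u" arbitrary: u rule: less_induct)
  case less
  show ?case
  proof (cases "u = v")
    case False
    obtain u' where u': "bruhat_step n u u'"
      "\<And>i j. i \<le> n \<Longrightarrow> j \<le> n \<Longrightarrow> rank_NW u' i j \<le> rank_NW v i j"
      using rank_le_imp_bruhat_step[OF less.prems(1) v False less.prems(2)] by metis
    have "perm_length n u < perm_length n u'"
      using u'(1) by (auto simp: bruhat_step_def)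
    then have "n * n - perm_length n u' < n * n - perm_length n u"
      using perm_length_le[of n u'] by linarith
    then have "(bruhat_step n)\<^sup>*\<^sup>* u' v"
      using less.hyps u'(2) bruhat_step_permutes[OF u'(1) less.prems(1)] by blast
    then show ?thesis
      using u'(1) by (metis converse_rtranclp_into_rtranclp)
  qed simp
qed

lemma bruhat_leI:
  assumes "u permutes {1..n}" and "v permutes {1..n}"
    and "\<And>i j. i \<le> n \<Longrightarrow> j \<le> n \<Longrightarrow> rank_NW u i j \<le> rank_NW v i j"
  shows "bruhat_le n u v"
  using assms rank_le_imp_bruhat_steps by (simp add: bruhat_le_def)

lemma bruhat_le_rank: "bruhat_le n u v \<Longrightarrow> rank_NW u i j \<le> rank_NW v i j"
  unfolding bruhat_le_def using bruhat_steps_rank_mono by blast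

lemma bruhat_le_antisym: "bruhat_le n u v \<Longrightarrow> bruhat_le n v u \<Longrightarrow> u = v"
  by (rule rank_NW_eq_imp_eq[of _ n])
    (unfold bruhat_le_def, blast, blast, blast intro: order_antisym bruhat_steps_rank_mono)

lemma bruhat_le_trans: "bruhat_le n u v \<Longrightarrow> bruhat_le n v z \<Longrightarrow> bruhat_le n u z"
  by (auto simp: bruhat_le_def)

section \<open>Cobigrassmannian permutations\<close>

lemma cobigrassmannian_eq:
  assumes "1 \<le> x" "x \<le> n0 + n1 + n2 + n3"
  shows "cobigrassmannian n0 n1 n2 n3 x =
    (if x \<le> n0 then n0 + n1 + n2 + n3 + 1 - x
     else if x \<le> n0 + n1 then n0 + n1 + n3 + 1 - x
     else if x \<le> n0 + n1 + n2 then n0 + n1 + n1 + n2 + n3 + 1 - x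
     else n0 + n1 + n2 + n3 + 1 - x)"
  using assms
  by (auto simp: cobigrassmannian_def cobigrassmannian_word_def nth_append rev_nth
      simp del: upt_Suc)

lemma cobigrassmannian_permutes:
  "cobigrassmannian n0 n1 n2 n3 permutes {1..n0 + n1 + n2 + n3}"
proof (rule bij_imp_permutes)
  let ?c = "cobigrassmannian n0 n1 n2 n3" and ?S = "{1..n0 + n1 + n2 + n3}"
  have "inj_on ?c ?S"
    by (rule inj_onI) (auto simp: cobigrassmannian_eq split: if_splits)
  moreover have "?c ` ?S \<subseteq> ?S"
    by (auto simp: cobigrassmannian_eq)
  ultimately show "bij_betw ?c ?S ?S"
    by (simp add: bij_betw_def endo_inj_surj)
qed (auto simp: cobigrassmannian_def)

text \<open>The three terms are the general bounds from the number of columns, from the number of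
  rows, and from the corner \<open>(n0 + n1, n1 + n3)\<close> of rank \<open>n0\<close>; the least
  of them is attained everywhere.\<close>

lemma rank_NW_cobigrassmannian:
  assumes "n0 + n1 + n2 + n3 = n" "i \<le> n" "j \<le> n"
  shows "rank_NW (cobigrassmannian n0 n1 n2 n3) i j =
    int (min i (min (n - j) (n0 + (i - (n0 + n1)) + (n1 + n3 - j))))"
  using assms(2)
proof (induction i)
  case (Suc i)
  have "cobigrassmannian n0 n1 n2 n3 (Suc i) =
    (if i < n0 then n - i
     else if i < n0 + n1 then n0 + n1 + n3 - i
     else if i < n0 + n1 + n2 then n + n1 - i
     else n - i)"
    using Suc.prems assms(1) by (subst cobigrassmannian_eq) auto
  moreover have "min (Suc i) (min (n - j) (n0 + (Suc i - (n0 + n1)) + (n1 + n3 - j))) =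
    min i (min (n - j) (n0 + (i - (n0 + n1)) + (n1 + n3 - j))) +
    of_bool (j < (if i < n0 then n - i
      else if i < n0 + n1 then n0 + n1 + n3 - i
      else if i < n0 + n1 + n2 then n + n1 - i
      else n - i))" (is ?step)
  proof -
    \<comment> \<open>Additive witnesses replace truncated differences. The cases are the four
      blocks, the second one split by the position of \<open>j\<close> relative to the corner
      row.\<close>
    obtain d where d: "n = j + d"
      using assms(3) le_Suc_ex by blast
    consider "i < n0" | "n0 \<le> i" "i < n0 + n1" "j \<le> n1 + n3"
      | "n0 \<le> i" "i < n0 + n1" "n1 + n3 < j"
      | f where "i = n0 + n1 + f" "f < n2" | f where "i = n0 + n1 + n2 + f" "f < n3"
      using Suc.prems assms(1)
      by (metis Suc_le_lessD add_less_cancel_left le_Suc_ex not_le_imp_less)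
    then show ?step
    proof cases
      case 2
      then obtain e where "n1 + n3 = j + e"
        using le_Suc_ex by blast
      then show ?step using assms(1) d 2 by (auto simp: min_def)
    next
      case (4 f)
      then show ?step using assms(1) d by (cases "j \<le> n1 + n3") (auto simp: min_def)
    next
      case (5 f)
      then show ?step using assms(1) d by (cases "j \<le> n1 + n3") (auto simp: min_def)
    qed (use assms(1) d in \<open>auto simp: min_def\<close>)
  qed
  ultimately show ?case
    using Suc by (simp only: rank_NW_Suc of_nat_add of_nat_of_bool Suc_leD)
qed simp

text \<open>
  The rank conditions defining the elements below a cobigrassmannian permutation all follow from
  the one at its corner.
\<close>

lemma bruhat_le_cobigrassmannian_iff:
  assumes "n0 + n1 + n2 + n3 = n" and z: "z permutes {1..n}"
  shows "bruhat_le n z (cobigrassmannian n0 n1 n2 n3) \<longleftrightarrow>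
    rank_NW z (n0 + n1) (n1 + n3) \<le> int n0"
proof
  assume "bruhat_le n z (cobigrassmannian n0 n1 n2 n3)"
  from bruhat_le_rank[OF this, of "n0 + n1" "n1 + n3"]
  show "rank_NW z (n0 + n1) (n1 + n3) \<le> int n0"
    using assms(1) by (subst (asm) rank_NW_cobigrassmannian) auto
next
  assume le: "rank_NW z (n0 + n1) (n1 + n3) \<le> int n0"
  show "bruhat_le n z (cobigrassmannian n0 n1 n2 n3)"
  proof (rule bruhat_leI[OF z])
    show "cobigrassmannian n0 n1 n2 n3 permutes {1..n}"
      using cobigrassmannian_permutes[of n0 n1 n2 n3] assms(1) by simp
    fix i j assume ij: "i \<le> n" "j \<le> n"
    have "rank_NW z i j \<le> rank_NW z (n0 + n1) j + int (i - (n0 + n1))"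
      by (rule rank_NW_le_add_columns)
    also have "rank_NW z (n0 + n1) j \<le> rank_NW z (n0 + n1) (n1 + n3) + int (n1 + n3 - j)"
      by (rule rank_NW_le_add_rows[OF permutes_inj[OF z]])
    finally show "rank_NW z i j \<le> rank_NW (cobigrassmannian n0 n1 n2 n3) i j"
      using le rank_NW_le_columns[of z i j] rank_NW_le_rows[OF z ij(1), of j]
      unfolding rank_NW_cobigrassmannian[OF assms(1) ij] by simp
  qed
qed

section \<open>Chains of Bruhat steps\<close>

text \<open>A step raises the rank at \<open>(p, q)\<close> by at most one, so the permutation just
  before the last increase serves.\<close>

lemma bruhat_steps_intermediate_rank:
  assumes "(bruhat_step n)\<^sup>*\<^sup>* z w" and "z permutes {1..n}"
    and "rank_NW z p q < rank_NW w p q"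
  obtains z' where "(bruhat_step n)\<^sup>*\<^sup>* z z'" "(bruhat_step n)\<^sup>*\<^sup>* z' w"
    "rank_NW w p q = rank_NW z' p q + 1"
proof -
  have "\<exists>z'. (bruhat_step n)\<^sup>*\<^sup>* z z' \<and> (bruhat_step n)\<^sup>*\<^sup>* z' w \<and>
    rank_NW w p q = rank_NW z' p q + 1"
    using assms
  proof (induction rule: rtranclp_induct)
    case (step y v)
    have y: "y permutes {1..n}"
      using bruhat_steps_permutes step by blast
    show ?case
    proof (cases "rank_NW y p q < rank_NW v p q")
      case True
      then show ?thesis
        using bruhat_step_rank_mono(2)[OF step.hyps(2) y, of p q] step.hyps
        by (intro exI[of _ y]) auto
    next
      case False
      then have "rank_NW v p q = rank_NW y p q"
        using bruhat_step_rank_mono(1)[OF step.hyps(2) y, of p q] by simp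
      then show ?thesis
        using step by (metis rtranclp.rtrancl_into_rtrancl)
    qed
  qed simp
  then show ?thesis
    using that by blast
qed

text \<open>
  Along a chain from \<open>z\<close>, a point of \<open>NO\<close> spanning with \<open>(p, q)\<close> a rectangle on which the rank
  has increased is created when the rank at \<open>(p, q)\<close> first increases, and it survives every later
  step, possibly moved to the other end of the transposition.
\<close>

lemma bruhat_steps_NO_rectangle:
  assumes "(bruhat_step n)\<^sup>*\<^sup>* z u" and "z permutes {1..n}"
    and "rank_NW z p q < rank_NW u p q"
  shows "\<exists>x. 1 \<le> x \<and> x \<le> p \<and> x \<le> n \<and> q < u x \<and>
    (\<forall>i j. x \<le> i \<and> i \<le> p \<and> q \<le> j \<and> j < u x \<longrightarrow> rank_NW z i j < rank_NW u i j)"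
  using assms
proof (induction rule: rtranclp_induct)
  case (step u v)
  have u: "u permutes {1..n}"
    using bruhat_steps_permutes step by blast
  obtain a b where ab: "1 \<le> a" "a < b" "b \<le> n" "u a < u b" and v: "v = u \<circ> transpose a b"
    and rank: "\<And>i j. rank_NW v i j = rank_NW u i j + of_bool (a \<le> i \<and> i < b \<and> u a \<le> j \<and> j < u b)"
    using bruhat_stepE[OF step.hyps(2) u] by metis
  have va: "v a = u b" and vb: "v b = u a"
    by (auto simp: v)
  have zu: "rank_NW z i j \<le> rank_NW u i j" for i j
    using bruhat_steps_rank_mono step by blast
  have uv: "rank_NW u i j \<le> rank_NW v i j" for i j
    by (simp add: rank)
  have new: "rank_NW z i j < rank_NW v i j" if "a \<le> i" "i < b" "u a \<le> j" "j < u b" for i j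
    using zu[of i j] that by (simp add: rank)
  show ?case
  proof (cases "rank_NW z p q < rank_NW u p q")
    case True
    then obtain x where x: "1 \<le> x" "x \<le> p" "x \<le> n" "q < u x"
      and "\<forall>i j. x \<le> i \<and> i \<le> p \<and> q \<le> j \<and> j < u x \<longrightarrow> rank_NW z i j < rank_NW u i j"
      using step.IH[OF step.prems(1)] by blast
    then have old: "rank_NW z i j < rank_NW v i j" if "x \<le> i" "i \<le> p" "q \<le> j" "j < u x" for i j
      using that uv[of i j] by (meson order_less_le_trans)
    \<comment> \<open>If the step moves the point, either its value reappears inside
      \<open>NO\<close> and the rectangle shrinks, or the rectangle grows only by cells where this
      very step raised the rank.\<close>
    consider "x \<noteq> a" "x \<noteq> b" | "x = a" "b \<le> p" | "x = a" "p < b" | "x = b" "q < u a"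
      | "x = b" "u a \<le> q"
      by linarith
    then show ?thesis
    proof cases
      case 1
      then have "v x = u x" by (simp add: v)
      then show ?thesis using x old by (intro exI[of _ x]) auto
    next
      case 2
      then show ?thesis using x old ab vb by (intro exI[of _ b]) auto
    next
      case 3
      have "rank_NW z i j < rank_NW v i j" if "a \<le> i" "i \<le> p" "q \<le> j" "j < u b" for i j
        using old[of i j] new[of i j] that 3 by (cases "j < u a") auto
      then show ?thesis using x ab va 3 by (intro exI[of _ a]) auto
    next
      case 4
      then show ?thesis using x old ab vb by (intro exI[of _ b]) auto
    next
      case 5
      have "rank_NW z i j < rank_NW v i j" if "a \<le> i" "i \<le> p" "q \<le> j" "j < u b" for i j
        using old[of i j] new[of i j] that 5 by (cases "i < b") auto
      then show ?thesis using x ab va 5 by (intro exI[of _ a]) auto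
    qed
  next
    case False
    then have "a \<le> p" "p < b" "u a \<le> q" "q < u b"
      using step.prems(2) rank[of p q] by (auto simp: of_bool_def split: if_splits)
    then show ?thesis using ab va new by (intro exI[of _ a]) auto
  qed
qed simp

text \<open>A half-turn of the picture about \<open>(p, q)\<close> turns the \<open>NO\<close>
  argument into this one, exchanging the roles of \<open>a\<close> and \<open>b\<close>.\<close>

lemma bruhat_steps_SE_rectangle:
  assumes "(bruhat_step n)\<^sup>*\<^sup>* z u" and "z permutes {1..n}"
    and "rank_NW z p q < rank_NW u p q"
  shows "\<exists>x. 1 \<le> x \<and> p < x \<and> x \<le> n \<and> u x \<le> q \<and>
    (\<forall>i j. p \<le> i \<and> i < x \<and> u x \<le> j \<and> j \<le> q \<longrightarrow> rank_NW z i j < rank_NW u i j)"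
  using assms
proof (induction rule: rtranclp_induct)
  case (step u v)
  have u: "u permutes {1..n}"
    using bruhat_steps_permutes step by blast
  obtain a b where ab: "1 \<le> a" "a < b" "b \<le> n" "u a < u b" and v: "v = u \<circ> transpose a b"
    and rank: "\<And>i j. rank_NW v i j = rank_NW u i j + of_bool (a \<le> i \<and> i < b \<and> u a \<le> j \<and> j < u b)"
    using bruhat_stepE[OF step.hyps(2) u] by metis
  have va: "v a = u b" and vb: "v b = u a"
    by (auto simp: v)
  have zu: "rank_NW z i j \<le> rank_NW u i j" for i j
    using bruhat_steps_rank_mono step by blast
  have uv: "rank_NW u i j \<le> rank_NW v i j" for i j
    by (simp add: rank)
  have new: "rank_NW z i j < rank_NW v i j" if "a \<le> i" "i < b" "u a \<le> j" "j < u b" for i j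
    using zu[of i j] that by (simp add: rank)
  show ?case
  proof (cases "rank_NW z p q < rank_NW u p q")
    case True
    then obtain x where x: "1 \<le> x" "p < x" "x \<le> n" "u x \<le> q"
      and "\<forall>i j. p \<le> i \<and> i < x \<and> u x \<le> j \<and> j \<le> q \<longrightarrow> rank_NW z i j < rank_NW u i j"
      using step.IH[OF step.prems(1)] by blast
    then have old: "rank_NW z i j < rank_NW v i j" if "p \<le> i" "i < x" "u x \<le> j" "j \<le> q" for i j
      using that uv[of i j] by (meson order_less_le_trans)
    consider "x \<noteq> a" "x \<noteq> b" | "x = b" "p < a" | "x = b" "a \<le> p" | "x = a" "u b \<le> q"
      | "x = a" "q < u b"
      by linarith
    then show ?thesis
    proof cases
      case 1
      then have "v x = u x" by (simp add: v)
      then show ?thesis using x old by (intro exI[of _ x]) auto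
    next
      case 2
      then show ?thesis using x old ab va by (intro exI[of _ a]) auto
    next
      case 3
      have "rank_NW z i j < rank_NW v i j" if "p \<le> i" "i < b" "u a \<le> j" "j \<le> q" for i j
        using old[of i j] new[of i j] that 3 by (cases "j < u b") auto
      then show ?thesis using x ab vb 3 by (intro exI[of _ b]) auto
    next
      case 4
      then show ?thesis using x old ab va by (intro exI[of _ a]) auto
    next
      case 5
      have "rank_NW z i j < rank_NW v i j" if "p \<le> i" "i < b" "u a \<le> j" "j \<le> q" for i j
        using old[of i j] new[of i j] that 5 by (cases "i < a") auto
      then show ?thesis using x ab vb 5 by (intro exI[of _ b]) auto
    qed
  next
    case False
    then have "a \<le> p" "p < b" "u a \<le> q" "q < u b"
      using step.prems(2) rank[of p q] by (auto simp: of_bool_def split: if_splits)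
    then show ?thesis using ab vb new by (intro exI[of _ b]) auto
  qed
qed simp

section \<open>The rank function of \<open>tau\<close>\<close>

text \<open>Written along a list so that it telescopes over a stretch where \<open>P\<close> holds
  and vanishes over a stretch where it fails.\<close>

fun path_sum :: "('a \<Rightarrow> bool) \<Rightarrow> ('a \<Rightarrow> int) \<Rightarrow> 'a list \<Rightarrow> int" where
  "path_sum P g (x # y # xs) = (if P x then g x - g y else 0) + path_sum P g (y # xs)"
| "path_sum P g _ = 0"

lemma path_sum_append:
  "path_sum P g (xs @ x # ys) = path_sum P g (xs @ [x]) + path_sum P g (x # ys)"
  by (induction P g xs rule: path_sum.induct) auto

lemma path_sum_telescope:
  "xs \<noteq> [] \<Longrightarrow> (\<And>x. x \<in> set (butlast xs) \<Longrightarrow> P x) \<Longrightarrow> path_sum P g xs = g (hd xs) - g (last xs)"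
  by (induction P g xs rule: path_sum.induct) auto

lemma path_sum_eq_0:
  "(\<And>x. x \<in> set (butlast xs) \<Longrightarrow> \<not> P x) \<Longrightarrow> path_sum P g xs = 0"
  by (induction P g xs rule: path_sum.induct) auto

lemma sum_list_eq_path_sum:
  assumes "map t (x # xs) = map w (xs @ [z])"
  shows "(\<Sum>a\<leftarrow>x # xs. if P a then g (w a) - g (t a) else 0) =
    path_sum P (\<lambda>a. g (w a)) (x # xs @ [z])"
  using assms by (induction xs arbitrary: x) auto

text \<open>Composing with the cycle gives each listed position the value of \<open>w\<close> at the
  next one and changes nothing else, so the rank drop is a sum along a closed path.\<close>

lemma rank_NW_cycle:
  assumes dist: "distinct (map w (x # xs))" and pos: "0 \<notin> set (x # xs)"
    and t: "t = cycle_of_list (map w (x # xs)) \<circ> w" and "inj w"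
  shows "rank_NW w i j - rank_NW t i j =
    path_sum (\<lambda>a. a \<le> i) (\<lambda>a. of_bool (j < w a)) (x # xs @ [x])"
proof -
  let ?L = "x # xs" and ?F = "\<lambda>a. of_bool (j < w a) - of_bool (j < t a) :: int"
  have "map t ?L = map (cycle_of_list (map w ?L)) (map w ?L)"
    unfolding t by simp
  also have "\<dots> = rotate1 (map w ?L)"
    using cyclic_rotation[OF dist, of 1] by simp
  finally have rot: "map t ?L = map w (xs @ [x])"
    by simp
  have out: "t a = w a" if "a \<notin> set ?L" for a
  proof -
    have "w a \<notin> set (map w ?L)"
      using that \<open>inj w\<close> by (auto simp: inj_eq)
    then show ?thesis
      unfolding t comp_def by (rule id_outside_supp)
  qed
  have "rank_NW w i j - rank_NW t i j = (\<Sum>a = 1..i. ?F a)"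
    by (simp add: rank_NW_def sum_subtractf)
  also have "\<dots> = (\<Sum>a \<in> {a \<in> set ?L. a \<le> i}. ?F a)"
  proof (rule sum.mono_neutral_right)
    show "{a \<in> set ?L. a \<le> i} \<subseteq> {1..i}"
      using pos by (auto simp: Suc_le_eq intro: gr0I)
    show "\<forall>a\<in>{1..i} - {a \<in> set ?L. a \<le> i}. ?F a = 0"
    proof
      fix a assume "a \<in> {1..i} - {a \<in> set ?L. a \<le> i}"
      then have "t a = w a" by (intro out) auto
      then show "?F a = 0" by simp
    qed
  qed simp
  also have "\<dots> = (\<Sum>a \<in> set ?L. if a \<le> i then ?F a else 0)"
    by (rule sum.inter_filter) simp
  also have "\<dots> = (\<Sum>a\<leftarrow>?L. if a \<le> i then ?F a else 0)"
    using dist by (subst sum_list_distinct_conv_sum_set) (auto simp: distinct_map)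
  also have "\<dots> = path_sum (\<lambda>a. a \<le> i) (\<lambda>a. of_bool (j < w a)) (x # xs @ [x])"
    by (rule sum_list_eq_path_sum[OF rot])
  finally show ?thesis .
qed

text \<open>
  The positions \<open>(i, j)\<close> enclosed between the two staircases; \<open>a\<close> and \<open>b\<close> are the abscissas of
  the points with indices +infinity and -infinity.
\<close>

definition tau_region :: "nat \<Rightarrow> nat \<Rightarrow> (nat \<Rightarrow> nat) \<Rightarrow> nat \<Rightarrow> nat \<Rightarrow> nat \<Rightarrow> nat \<Rightarrow> bool" where
  "tau_region p q w a b i j \<longleftrightarrow> a \<le> i \<and> i < b \<and> w b \<le> j \<and> j < w a \<and>
     (\<forall>x. a < x \<and> i < x \<and> x \<le> p \<and> w x \<le> q \<longrightarrow> w x \<le> j) \<and>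
     (\<forall>x. p < x \<and> x \<le> i \<and> x < b \<and> q < w x \<longrightarrow> j < w x)"

section \<open>The two staircases of a pair of points\<close>

locale tau_data =
  fixes n p q :: nat and w :: "nat \<Rightarrow> nat" and a b :: nat
  assumes w: "w permutes {1..n}"
    and ab: "1 \<le> a" "a \<le> p" "p < b" "b \<le> n" "w b \<le> q" "q < w a"
begin

definition W where "W = fst ` NE_boundary (SO n p q w \<inter> open_rect (a, w a) (b, w b))"
definition E where "E = fst ` SW_boundary (NE n p q w \<inter> open_rect (a, w a) (b, w b))"

text \<open>The rectangle disappears from the maximality condition because a point of
  \<open>SO\<close> dominating a point of the rectangle is itself in the rectangle.\<close>

lemma W_iff: "x \<in> W \<longleftrightarrow> a < x \<and> x \<le> p \<and> w b < w x \<and> w x \<le> q \<and>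
    \<not> (\<exists>x'. x < x' \<and> x' \<le> p \<and> w x < w x' \<and> w x' \<le> q)"
  using ab unfolding W_def NE_boundary_def SO_def perm_graph_def open_rect_def
  by (fastforce simp: image_iff)

lemma E_iff: "x \<in> E \<longleftrightarrow> p < x \<and> x < b \<and> q < w x \<and> w x < w a \<and>
    \<not> (\<exists>x'. p < x' \<and> x' < x \<and> q < w x' \<and> w x' < w x)"
  using ab unfolding E_def SW_boundary_def NE_def perm_graph_def open_rect_def
  by (fastforce simp: image_iff)

lemma finite_W: "finite W" and finite_E: "finite E"
  by (rule finite_subset[of _ "{..p}"], auto simp: W_iff)
    (rule finite_subset[of _ "{..b}"], auto simp: E_iff)

definition ws where "ws = sorted_list_of_set W"
definition es where "es = sorted_list_of_set E"

abbreviation "\<tau> \<equiv> tau n p q w (a, w a) (b, w b)"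

lemma set_ws [simp]: "set ws = W" and set_es [simp]: "set es = E"
  by (simp_all add: ws_def es_def finite_W finite_E)

lemma tau_eq: "\<tau> = cycle_of_list (map w (a # ws @ b # rev es)) \<circ> w"
  by (simp add: tau_def gamma_entries_def ws_def es_def W_def E_def)

lemma distinct_positions: "distinct (a # ws @ b # rev es)"
  using ab by (auto simp: W_iff E_iff) (auto simp: ws_def es_def)

lemma tau_permutes: "\<tau> permutes {1..n}"
proof -
  have "x \<in> {1..n}" if "x \<in> set (a # ws @ b # rev es)" for x
    using that ab by (auto simp: W_iff E_iff)
  then have "set (map w (a # ws @ b # rev es)) \<subseteq> {1..n}"
    using permutes_in_image[OF w] by (metis (no_types, lifting) image_subsetI list.set_map)
  then show ?thesis
    unfolding tau_eq by (intro permutes_compose[OF w] permutes_subset[OF cycle_permutes])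
qed

text \<open>Among the points of \<open>SO\<close> weakly above and to the right of the given one,
  the rightmost is dominated by none.\<close>

lemma W_dominates:
  assumes "a < x" "x \<le> p" "w b < w x" "w x \<le> q"
  obtains x' where "x' \<in> W" "x \<le> x'" "w x \<le> w x'"
proof -
  define S where "S = {x'. x \<le> x' \<and> x' \<le> p \<and> w x \<le> w x' \<and> w x' \<le> q}"
  have S: "finite S" "x \<in> S"
    using assms by (auto simp: S_def intro: finite_subset[of _ "{..p}"])
  obtain m where m: "m \<in> S" "\<And>x'. x' \<in> S \<Longrightarrow> x' \<le> m"
    using Max_in[of S] Max_ge[of S] S by blast
  have "m \<in> W"
    unfolding W_iff
  proof (intro conjI notI)
    assume "\<exists>x'. m < x' \<and> x' \<le> p \<and> w m < w x' \<and> w x' \<le> q"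
    then obtain x' where x': "m < x'" "x' \<le> p" "w m < w x'" "w x' \<le> q"
      by blast
    then have "x' \<in> S"
      using m(1) by (auto simp: S_def)
    then show False
      using x'(1) m(2) by (simp add: leD)
  qed (use m(1) assms in \<open>auto simp: S_def\<close>)
  with m(1) show ?thesis
    by (intro that[of m]) (auto simp: S_def)
qed

lemma E_dominates:
  assumes "p < x" "x < b" "q < w x" "w x < w a"
  obtains x' where "x' \<in> E" "x' \<le> x" "w x' \<le> w x"
proof -
  define S where "S = {x'. p < x' \<and> x' \<le> x \<and> q < w x' \<and> w x' \<le> w x}"
  have S: "finite S" "x \<in> S"
    using assms by (auto simp: S_def intro: finite_subset[of _ "{..x}"])
  obtain m where m: "m \<in> S" "\<And>x'. x' \<in> S \<Longrightarrow> m \<le> x'"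
    using Min_in[of S] Min_le[of S] S by blast
  have "m \<in> E"
    unfolding E_iff
  proof (intro conjI notI)
    assume "\<exists>x'. p < x' \<and> x' < m \<and> q < w x' \<and> w x' < w m"
    then obtain x' where x': "p < x'" "x' < m" "q < w x'" "w x' < w m"
      by blast
    then have "x' \<in> S"
      using m(1) by (auto simp: S_def)
    then show False
      using x'(2) m(2) by (simp add: leD)
  qed (use m(1) assms in \<open>auto simp: S_def\<close>)
  with m(1) show ?thesis
    by (intro that[of m]) (auto simp: S_def)
qed

text \<open>The closed path runs rightwards from \<open>a\<close> to \<open>b\<close> through
  \<open>ws\<close> and back through \<open>es\<close>. Cut at column \<open>i\<close>, its halves
  telescope to \<open>?g a - ?g f\<close> and \<open>?g h - ?g a\<close>, where \<open>f\<close> and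
  \<open>h\<close> are the crossing points. Since \<open>w f \<le> q < w h\<close>, the total is the
  indicator of \<open>w f \<le> j < w h\<close>.\<close>

lemma rank_NW_tau: "rank_NW \<tau> i j = rank_NW w i j - of_bool (tau_region p q w a b i j)"
proof -
  let ?P = "\<lambda>x. x \<le> i" and ?g = "\<lambda>x. of_bool (j < w x) :: int"
  have "rank_NW w i j - rank_NW \<tau> i j = path_sum ?P ?g (a # (ws @ b # rev es) @ [a])"
  proof (rule rank_NW_cycle[OF _ _ tau_eq permutes_inj[OF w]])
    show "distinct (map w (a # ws @ b # rev es))"
      using distinct_positions inj_on_subset[OF permutes_inj[OF w]]
      by (simp only: distinct_map) blast
    show "0 \<notin> set (a # ws @ b # rev es)"
      using ab by (auto simp: W_iff E_iff)
  qed
  also have "\<dots> = path_sum ?P ?g (a # ws @ [b]) + path_sum ?P ?g (b # rev es @ [a])"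
    using path_sum_append[of ?P ?g "a # ws" b "rev es @ [a]"] by simp
  finally have sum: "rank_NW w i j - rank_NW \<tau> i j =
    path_sum ?P ?g (a # ws @ [b]) + path_sum ?P ?g (b # rev es @ [a])" .
  have between: "a < x \<and> x < b" if "x \<in> W \<union> E" for x
    using that ab by (auto simp: W_iff E_iff)
  consider "i < a" | "b \<le> i" | "a \<le> i" "i < b"
    by linarith
  then show ?thesis
  proof cases
    case 1
    have "path_sum ?P ?g (a # ws @ [b]) = 0" "path_sum ?P ?g (b # rev es @ [a]) = 0"
      using 1 between ab by (auto intro!: path_sum_eq_0 simp: butlast_append) fastforce+
    with sum 1 show ?thesis
      by (simp add: tau_region_def)
  next
    case 2
    have "path_sum ?P ?g (a # ws @ [b]) = ?g a - ?g b"
      using 2 between ab by (subst path_sum_telescope) (auto simp: butlast_append, fastforce)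
    moreover have "path_sum ?P ?g (b # rev es @ [a]) = ?g b - ?g a"
      using 2 between ab by (subst path_sum_telescope) (auto simp: butlast_append, fastforce)
    ultimately show ?thesis
      using sum 2 by (simp add: tau_region_def)
  next
    case 3
    have "\<exists>x\<in>set (ws @ [b]). i < x"
      using 3 by simp
    \<comment> \<open>\<open>f\<close> is the first abscissa beyond \<open>i\<close> on the way to
      \<open>b\<close>, with \<open>b\<close> itself as sentinel.\<close>
    then obtain ys f zs where f: "ws @ [b] = ys @ f # zs" "i < f" "\<forall>y\<in>set ys. \<not> i < y"
      using split_list_first_prop[of "ws @ [b]" "\<lambda>x. i < x"] by blast
    have "sorted_wrt (<) (ws @ [b])"
      using between by (simp add: sorted_wrt_append) (simp add: ws_def)
    then have zs: "\<forall>z\<in>set zs. f < z"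
      by (simp add: f(1) sorted_wrt_append)
    have setf: "insert b W = set ys \<union> insert f (set zs)"
      using arg_cong[OF f(1), of set] by simp
    have f_least: "f \<le> x" if "x \<in> W" "i < x" for x
    proof -
      have "x \<in> set ys \<union> insert f (set zs)"
        using that setf by blast
      then show ?thesis
        using that f(3) zs by auto
    qed
    have fW: "f = b \<or> f \<in> W"
      using setf by blast
    have "path_sum ?P ?g (a # ws @ [b]) = path_sum ?P ?g ((a # ys) @ [f]) + path_sum ?P ?g (f # zs)"
      using path_sum_append[of ?P ?g "a # ys" f zs] f(1) by simp
    also have "path_sum ?P ?g (f # zs) = 0"
    proof (rule path_sum_eq_0)
      fix x assume "x \<in> set (butlast (f # zs))"
      then have "x \<in> set (f # zs)"
        by (rule in_set_butlastD)
      then show "\<not> x \<le> i"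
        using f(2) zs by auto
    qed
    also have "path_sum ?P ?g ((a # ys) @ [f]) = ?g a - ?g f"
      using 3 f(3) by (subst path_sum_telescope) (auto simp: butlast_append not_less)
    finally have west: "path_sum ?P ?g (a # ws @ [b]) = ?g a - ?g f"
      by simp
    have "\<exists>x\<in>set (rev es @ [a]). x \<le> i"
      using 3 by simp
    \<comment> \<open>On the way back, \<open>h\<close> is the first abscissa at most
      \<open>i\<close>, hence the greatest such one; \<open>a\<close> is the sentinel.\<close>
    then obtain ys' h zs' where h: "rev es @ [a] = ys' @ h # zs'" "h \<le> i" "\<forall>y\<in>set ys'. \<not> y \<le> i"
      using split_list_first_prop[of "rev es @ [a]" "\<lambda>x. x \<le> i"] by blast
    have "sorted_wrt (>) (rev es @ [a])"
      using between by (simp add: sorted_wrt_append sorted_wrt_rev) (simp add: es_def)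
    then have zs': "\<forall>z\<in>set zs'. z < h"
      by (simp add: h(1) sorted_wrt_append)
    have seth: "insert a E = set ys' \<union> insert h (set zs')"
      using arg_cong[OF h(1), of set] by simp
    have h_greatest: "x \<le> h" if "x \<in> E" "x \<le> i" for x
    proof -
      have "x \<in> set ys' \<union> insert h (set zs')"
        using that seth by blast
      then show ?thesis
        using that h(3) zs' by auto
    qed
    have hE: "h = a \<or> h \<in> E"
      using seth by blast
    have "path_sum ?P ?g (b # rev es @ [a]) =
      path_sum ?P ?g ((b # ys') @ [h]) + path_sum ?P ?g (h # zs')"
      using path_sum_append[of ?P ?g "b # ys'" h zs'] h(1) by simp
    also have "path_sum ?P ?g ((b # ys') @ [h]) = 0"
      using 3 h(3) by (intro path_sum_eq_0) (auto simp: butlast_append)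
    also have "path_sum ?P ?g (h # zs') = ?g h - ?g (last (h # zs'))"
    proof (subst path_sum_telescope)
      fix x assume "x \<in> set (butlast (h # zs'))"
      then have "x \<in> set (h # zs')"
        by (rule in_set_butlastD)
      then show "x \<le> i"
        using h(2) zs' by auto
    qed auto
    also have "last (h # zs') = a"
      using arg_cong[OF h(1), of last] by simp
    finally have east: "path_sum ?P ?g (b # rev es @ [a]) = ?g h - ?g a"
      by simp
    have le: "w f \<le> q" "q < w h"
      using fW hE ab by (auto simp: W_iff E_iff)
    \<comment> \<open>Ordinates decrease along \<open>W\<close>, so \<open>f\<close> carries the
      largest one beyond \<open>i\<close>, and \<open>W_dominates\<close> reduces all other points
      of \<open>SO\<close> to \<open>W\<close>.\<close>
    have "w f \<le> j \<longleftrightarrow> w b \<le> j \<and> (\<forall>x. a < x \<and> i < x \<and> x \<le> p \<and> w x \<le> q \<longrightarrow> w x \<le> j)"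
    proof (intro iffI conjI allI impI)
      assume j: "w f \<le> j"
      show bj: "w b \<le> j"
        using fW j by (auto simp: W_iff)
      fix x assume x: "a < x \<and> i < x \<and> x \<le> p \<and> w x \<le> q"
      show "w x \<le> j"
      proof (cases "w b < w x")
        case True
        with x obtain x' where x': "x' \<in> W" "x \<le> x'" "w x \<le> w x'"
          using W_dominates by metis
        then have fx': "f \<le> x'"
          using f_least x by (meson less_le_trans)
        then have "f \<in> W"
          using fW between[of x'] x'(1) by auto
        then have "w x' \<le> w f"
          using fx' x'(1) unfolding W_iff by (metis le_neq_implies_less not_le_imp_less order_refl)
        then show ?thesis
          using x' j by simp
      qed (use bj in simp)
    qed (use fW f(2) in \<open>auto simp: W_iff\<close>)
    moreover have "j < w h \<longleftrightarrow> j < w a \<and> (\<forall>x. p < x \<and> x \<le> i \<and> x < b \<and> q < w x \<longrightarrow> j < w x)"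
    proof (intro iffI conjI allI impI)
      assume j: "j < w h"
      show aj: "j < w a"
        using hE j by (auto simp: E_iff)
      fix x assume x: "p < x \<and> x \<le> i \<and> x < b \<and> q < w x"
      show "j < w x"
      proof (cases "w x < w a")
        case True
        with x obtain x' where x': "x' \<in> E" "x' \<le> x" "w x' \<le> w x"
          using E_dominates by metis
        then have hx': "x' \<le> h"
          using h_greatest x by (meson le_trans)
        then have "h \<in> E"
          using hE between[of x'] x'(1) by auto
        then have "w h \<le> w x'"
          using hx' x'(1) unfolding E_iff by (metis le_neq_implies_less not_le_imp_less order_refl)
        then show ?thesis
          using x' j by simp
      qed (use aj in simp)
    qed (use hE h(2) in \<open>auto simp: E_iff\<close>)
    ultimately have "tau_region p q w a b i j \<longleftrightarrow> w f \<le> j \<and> j < w h"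
      unfolding tau_region_def using 3 by blast
    then show ?thesis
      using sum west east le by auto
  qed
qed

end

section \<open>Maximal elements\<close>

text \<open>Inclusion-exclusion: the last sum counts the points of the graph inside the rectangle
  spanned by the four positions.\<close>

lemma rank_NW_rectangle:
  assumes "i \<le> i'" and "j \<le> j'"
  shows "rank_NW u i' j + rank_NW u i j' =
    rank_NW u i j + rank_NW u i' j' + (\<Sum>a = Suc i..i'. of_bool (j < u a \<and> u a \<le> j'))"
proof -
  have "(\<Sum>a = Suc i..i'. of_bool (j < u a) :: int) =
    (\<Sum>a = Suc i..i'. of_bool (j' < u a) + of_bool (j < u a \<and> u a \<le> j'))"
    using assms(2) by (intro sum.cong) auto
  then show ?thesis
    using rank_NW_split[OF assms(1), of u j] rank_NW_split[OF assms(1), of u j']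
    by (simp only: sum.distrib)
qed

section \<open>Moving points to the boundaries\<close>

lemma boundary_NO_iff:
  "P \<in> boundary_NO n p q w \<longleftrightarrow> (\<exists>a. P = (a, w a) \<and> 1 \<le> a \<and> a \<le> n \<and> a \<le> p \<and> q < w a \<and>
     \<not> (\<exists>x. a < x \<and> x \<le> n \<and> x \<le> p \<and> q < w x \<and> w x < w a))"
  unfolding boundary_NO_def NO_def perm_graph_def by (cases P) fastforce

lemma boundary_SE_iff:
  "Q \<in> boundary_SE n p q w \<longleftrightarrow> (\<exists>b. Q = (b, w b) \<and> 1 \<le> b \<and> b \<le> n \<and> p < b \<and> w b \<le> q \<and>
     \<not> (\<exists>x. p < x \<and> x < b \<and> w b < w x \<and> w x \<le> q))"
  unfolding boundary_SE_def SE_def perm_graph_def by (cases Q) fastforce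

text \<open>The rightmost candidate is on the boundary. Moving to it shrinks the rectangle spanned
  with \<open>(p, q)\<close>, so rank inequalities there persist.\<close>

lemma boundary_NO_below:
  assumes "1 \<le> x" "x \<le> n" "x \<le> p" "q < w x"
  obtains a where "(a, w a) \<in> boundary_NO n p q w" "x \<le> a" "w a \<le> w x"
proof -
  define S where "S = {a. x \<le> a \<and> a \<le> n \<and> a \<le> p \<and> q < w a \<and> w a \<le> w x}"
  have S: "finite S" "x \<in> S"
    using assms by (auto simp: S_def intro: finite_subset[of _ "{..p}"])
  obtain m where m: "m \<in> S" "\<And>a. a \<in> S \<Longrightarrow> a \<le> m"
    using Max_in[of S] Max_ge[of S] S by blast
  show ?thesis
  proof (rule that[of m])
    have "\<not> (\<exists>x. m < x \<and> x \<le> n \<and> x \<le> p \<and> q < w x \<and> w x < w m)"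
    proof
      assume "\<exists>x. m < x \<and> x \<le> n \<and> x \<le> p \<and> q < w x \<and> w x < w m"
      then obtain x' where "m < x'" "x' \<in> S"
        using m(1) by (auto simp: S_def)
      then show False using m(2) by (simp add: leD)
    qed
    then show "(m, w m) \<in> boundary_NO n p q w"
      using m(1) assms(1) unfolding boundary_NO_iff S_def by auto
  qed (use m(1) in \<open>auto simp: S_def\<close>)
qed

lemma boundary_SE_above:
  assumes "1 \<le> x" "x \<le> n" "p < x" "w x \<le> q"
  obtains b where "(b, w b) \<in> boundary_SE n p q w" "b \<le> x" "w x \<le> w b"
proof -
  define S where "S = {b. b \<le> x \<and> p < b \<and> w b \<le> q \<and> w x \<le> w b}"
  have S: "finite S" "x \<in> S"
    using assms by (auto simp: S_def intro: finite_subset[of _ "{..x}"])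
  obtain m where m: "m \<in> S" "\<And>b. b \<in> S \<Longrightarrow> m \<le> b"
    using Min_in[of S] Min_le[of S] S by blast
  show ?thesis
  proof (rule that[of m])
    have "\<not> (\<exists>x. p < x \<and> x < m \<and> w m < w x \<and> w x \<le> q)"
    proof
      assume "\<exists>x. p < x \<and> x < m \<and> w m < w x \<and> w x \<le> q"
      then obtain x' where "x' < m" "x' \<in> S"
        using m(1) by (auto simp: S_def)
      then show False using m(2) by (simp add: leD)
    qed
    then show "(m, w m) \<in> boundary_SE n p q w"
      using m(1) assms(2) unfolding boundary_SE_iff S_def by auto
  qed (use m(1) in \<open>auto simp: S_def\<close>)
qed

lemma boundary_tau_data:
  assumes "w permutes {1..n}" "P \<in> boundary_NO n p q w" "Q \<in> boundary_SE n p q w"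
  obtains a b where "P = (a, w a)" "Q = (b, w b)" "tau_data n p q w a b"
  using assms unfolding boundary_NO_iff boundary_SE_iff tau_data_def by blast

context tau_data
begin

lemma tau_region_corner: "tau_region p q w a b p q"
  using ab by (auto simp: tau_region_def)

lemma tau_le: "bruhat_le n \<tau> w"
  using tau_permutes w by (rule bruhat_leI) (simp add: rank_NW_tau)

lemma rank_NW_tau_corner: "rank_NW \<tau> p q = rank_NW w p q - 1"
  by (simp add: rank_NW_tau tau_region_corner)

text \<open>Ranks are integers, so lowering the bound by the indicator of the region means
  strictness exactly on the region.\<close>

lemma le_tau_iff:
  assumes "bruhat_le n z w"
  shows "bruhat_le n z \<tau> \<longleftrightarrow> (\<forall>i j. tau_region p q w a b i j \<longrightarrow> rank_NW z i j < rank_NW w i j)"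
proof
  assume "bruhat_le n z \<tau>"
  show "\<forall>i j. tau_region p q w a b i j \<longrightarrow> rank_NW z i j < rank_NW w i j"
  proof (intro allI impI)
    fix i j assume "tau_region p q w a b i j"
    then show "rank_NW z i j < rank_NW w i j"
      using bruhat_le_rank[OF \<open>bruhat_le n z \<tau>\<close>, of i j] by (simp add: rank_NW_tau)
  qed
next
  assume "\<forall>i j. tau_region p q w a b i j \<longrightarrow> rank_NW z i j < rank_NW w i j"
  then have "rank_NW z i j \<le> rank_NW \<tau> i j" for i j
    using bruhat_le_rank[OF assms, of i j]
    by (cases "tau_region p q w a b i j") (auto simp: rank_NW_tau)
  moreover have "z permutes {1..n}"
    using assms by (simp add: bruhat_le_def)
  ultimately show "bruhat_le n z \<tau>"
    using tau_permutes by (intro bruhat_leI)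
qed

text \<open>
  When the rank at \<open>(p, q)\<close> drops by exactly one, the two rectangles control the whole region:
  a point of the region in another quadrant spans with \<open>(p, q)\<close> a rectangle containing no point
  of \<open>w\<close>, so the rank drop there is at least \<open>1 + 1 - 1\<close>.
\<close>

lemma le_tau_if_rectangles:
  assumes zw: "bruhat_le n z w" and drop: "rank_NW w p q = rank_NW z p q + 1"
    and NW: "\<And>i j. \<lbrakk>a \<le> i; i \<le> p; q \<le> j; j < w a\<rbrakk> \<Longrightarrow> rank_NW z i j < rank_NW w i j"
    and SE: "\<And>i j. \<lbrakk>p \<le> i; i < b; w b \<le> j; j \<le> q\<rbrakk> \<Longrightarrow> rank_NW z i j < rank_NW w i j"
  shows "bruhat_le n z \<tau>"
  unfolding le_tau_iff[OF zw]
proof (intro allI impI)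
  fix i j assume "tau_region p q w a b i j"
  then have ij: "a \<le> i" "i < b" "w b \<le> j" "j < w a"
    and SO: "\<And>x. \<lbrakk>a < x; i < x; x \<le> p; w x \<le> q\<rbrakk> \<Longrightarrow> w x \<le> j"
    and NE: "\<And>x. \<lbrakk>p < x; x \<le> i; x < b; q < w x\<rbrakk> \<Longrightarrow> j < w x"
    unfolding tau_region_def by blast+
  consider "i \<le> p" "q \<le> j" | "p \<le> i" "j \<le> q" | "i \<le> p" "j \<le> q" | "p \<le> i" "q \<le> j"
    by linarith
  then show "rank_NW z i j < rank_NW w i j"
  proof cases
    case 1
    then show ?thesis using NW ij by blast
  next
    case 2
    then show ?thesis using SE ij by blast
  next
    case 3
    have "(\<Sum>x = Suc i..p. of_bool (j < w x \<and> w x \<le> q) :: int) = 0"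
      using SO ij by (intro sum.neutral) (auto simp: not_le[symmetric])
    moreover have "(\<Sum>x = Suc i..p. of_bool (j < z x \<and> z x \<le> q) :: int) \<ge> 0"
      by (intro sum_nonneg) auto
    moreover have "rank_NW z i q < rank_NW w i q" "rank_NW z p j < rank_NW w p j"
      using 3 ij ab by (simp_all add: NW SE)
    ultimately show ?thesis
      using rank_NW_rectangle[OF 3, of w] rank_NW_rectangle[OF 3, of z] drop by linarith
  next
    case 4
    have "(\<Sum>x = Suc p..i. of_bool (q < w x \<and> w x \<le> j) :: int) = 0"
      using NE ij by (intro sum.neutral) (auto simp: not_le[symmetric])
    moreover have "(\<Sum>x = Suc p..i. of_bool (q < z x \<and> z x \<le> j) :: int) \<ge> 0"
      by (intro sum_nonneg) auto
    moreover have "rank_NW z p j < rank_NW w p j" "rank_NW z i q < rank_NW w i q"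
      using 4 ij ab by (simp_all add: NW SE)
    ultimately show ?thesis
      using rank_NW_rectangle[OF 4, of w] rank_NW_rectangle[OF 4, of z] drop by linarith
  qed
qed

end

section \<open>Domination by some \<open>tau\<close>, and incomparability\<close>

lemma ex_tau_above:
  assumes w: "w permutes {1..n}" and zw: "bruhat_le n z w"
    and less: "rank_NW z p q < rank_NW w p q"
  obtains P Q where "P \<in> boundary_NO n p q w" "Q \<in> boundary_SE n p q w"
    "bruhat_le n z (tau n p q w P Q)"
proof -
  have z: "z permutes {1..n}" and steps: "(bruhat_step n)\<^sup>*\<^sup>* z w"
    using zw by (auto simp: bruhat_le_def)
  \<comment> \<open>The inclusion-exclusion estimate requires a drop of exactly one at
    \<open>(p, q)\<close>, hence the passage from \<open>z\<close> to a larger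
    \<open>z'\<close>.\<close>
  obtain z' where z': "(bruhat_step n)\<^sup>*\<^sup>* z z'" "(bruhat_step n)\<^sup>*\<^sup>* z' w"
    and drop: "rank_NW w p q = rank_NW z' p q + 1"
    using bruhat_steps_intermediate_rank[OF steps z less] by metis
  have pz': "z' permutes {1..n}"
    using bruhat_steps_permutes[OF z'(1) z] .
  have less': "rank_NW z' p q < rank_NW w p q"
    using drop by simp
  obtain x where x: "1 \<le> x" "x \<le> p" "x \<le> n" "q < w x"
    and NW: "\<forall>i j. x \<le> i \<and> i \<le> p \<and> q \<le> j \<and> j < w x \<longrightarrow> rank_NW z' i j < rank_NW w i j"
    using bruhat_steps_NO_rectangle[OF z'(2) pz' less'] by blast
  obtain y where y: "1 \<le> y" "p < y" "y \<le> n" "w y \<le> q"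
    and SE: "\<forall>i j. p \<le> i \<and> i < y \<and> w y \<le> j \<and> j \<le> q \<longrightarrow> rank_NW z' i j < rank_NW w i j"
    using bruhat_steps_SE_rectangle[OF z'(2) pz' less'] by blast
  obtain a where a: "(a, w a) \<in> boundary_NO n p q w" "x \<le> a" "w a \<le> w x"
    using boundary_NO_below[of x n p q w] x by metis
  obtain b where b: "(b, w b) \<in> boundary_SE n p q w" "b \<le> y" "w y \<le> w b"
    using boundary_SE_above[of y n p w q] y by metis
  interpret tau_data n p q w a b
    using boundary_tau_data[OF w a(1) b(1)] by blast
  have "bruhat_le n z' w"
    using z' w pz' by (simp add: bruhat_le_def)
  then have "bruhat_le n z' \<tau>"
    using drop
  proof (rule le_tau_if_rectangles)
    show "rank_NW z' i j < rank_NW w i j" if "a \<le> i" "i \<le> p" "q \<le> j" "j < w a" for i j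
      using NW a that by (meson le_trans less_le_trans)
    show "rank_NW z' i j < rank_NW w i j" if "p \<le> i" "i < b" "w b \<le> j" "j \<le> q" for i j
      using SE b that by (meson le_trans less_le_trans)
  qed
  moreover have "bruhat_le n z z'"
    using z' z pz' by (simp add: bruhat_le_def)
  ultimately show ?thesis
    using that[OF a(1) b(1)] bruhat_le_trans by blast
qed

text \<open>
  The extent of the region along row \<open>q\<close> and along column \<open>p\<close> recovers the two points.
\<close>

lemma tau_le_tau_imp_eq:
  assumes w: "w permutes {1..n}"
    and P: "P \<in> boundary_NO n p q w" and Q: "Q \<in> boundary_SE n p q w"
    and P': "P' \<in> boundary_NO n p q w" and Q': "Q' \<in> boundary_SE n p q w"
    and le: "bruhat_le n (tau n p q w P Q) (tau n p q w P' Q')"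
  shows "P = P' \<and> Q = Q'"
proof -
  obtain a b where ab: "P = (a, w a)" "Q = (b, w b)" and "tau_data n p q w a b"
    using boundary_tau_data[OF w P Q] .
  then interpret X: tau_data n p q w a b
    by simp
  obtain a' b' where ab': "P' = (a', w a')" "Q' = (b', w b')" and "tau_data n p q w a' b'"
    using boundary_tau_data[OF w P' Q'] .
  then interpret Y: tau_data n p q w a' b'
    by simp
  \<comment> \<open>Both permutations subtract an indicator from the rank of \<open>w\<close>, so
    comparing them reverses the inclusion of regions.\<close>
  have sub: "tau_region p q w a b i j" if "tau_region p q w a' b' i j" for i j
    using le that unfolding ab ab' Y.le_tau_iff[OF X.tau_le]
    by (auto simp: X.rank_NW_tau of_bool_def split: if_splits)
  \<comment> \<open>These are the end cells of the region in row \<open>q\<close> and column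
    \<open>p\<close>; being half-open, it ends at \<open>b' - 1\<close> and
    \<open>w a' - 1\<close>.\<close>
  have "tau_region p q w a' b' a' q" "tau_region p q w a' b' p (w a' - 1)"
    "tau_region p q w a' b' (b' - 1) q" "tau_region p q w a' b' p (w b')"
    using X.ab Y.ab by (auto simp: tau_region_def)
  from this[THEN sub] have ineq: "a \<le> a'" "w a' \<le> w a" "b' \<le> b" "w b \<le> w b'"
    using Y.ab by (auto simp: tau_region_def)
  have inj: "x = y" if "w x = w y" for x y
    using that permutes_inj[OF w] by (simp add: inj_eq)
  have "a = a'"
  proof (rule ccontr)
    assume "a \<noteq> a'"
    then have "a < a'" "w a' < w a"
      using ineq inj by (metis le_neq_implies_less)+
    then show False
      using P Y.ab unfolding ab boundary_NO_iff by auto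
  qed
  moreover have "b = b'"
  proof (rule ccontr)
    assume "b \<noteq> b'"
    then have "b' < b" "w b < w b'"
      using ineq inj by (metis le_neq_implies_less)+
    then show False
      using Q Y.ab unfolding ab boundary_SE_iff by auto
  qed
  ultimately show ?thesis
    by (simp add: ab ab')
qed

theorem mainTheorem2:
  fixes n n\<^sub>0 n\<^sub>1 n\<^sub>2 n\<^sub>3 p q :: nat and c c\<^sub>1 w :: "nat \<Rightarrow> nat"
  assumes "n\<^sub>1 \<ge> 1" and "n\<^sub>2 \<ge> 1" and "n\<^sub>0 + n\<^sub>1 + n\<^sub>2 + n\<^sub>3 = n"
    and "n\<^sub>0 \<ge> 1" and "n\<^sub>3 \<ge> 1"
    and "c = cobigrassmannian n\<^sub>0 n\<^sub>1 n\<^sub>2 n\<^sub>3"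
    and "c\<^sub>1 = cobigrassmannian (n\<^sub>0 - 1) (n\<^sub>1 + 1) (n\<^sub>2 + 1) (n\<^sub>3 - 1)"
    and "p = n\<^sub>0 + n\<^sub>1" and "q = n\<^sub>1 + n\<^sub>3"
    and "w permutes {1..n}" and "bruhat_le n w c" and "\<not> bruhat_le n w c\<^sub>1"
  shows "{tau n p q w P Q | P Q. P \<in> boundary_NO n p q w \<and> Q \<in> boundary_SE n p q w}
           = bruhat_maximal n (Lambda n w c\<^sub>1)"
proof -
  note w = \<open>w permutes {1..n}\<close>
  have le_c: "bruhat_le n z c \<longleftrightarrow> rank_NW z p q \<le> int n\<^sub>0" if "z permutes {1..n}" for z
    using bruhat_le_cobigrassmannian_iff[OF assms(3) that] assms(6,8,9) by simp
  \<comment> \<open>The iterate has the same corner \<open>(p, q)\<close> and a first block shorter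
    by one, so the corner bound becomes strict.\<close>
  have le_c1: "bruhat_le n z c\<^sub>1 \<longleftrightarrow> rank_NW z p q < int n\<^sub>0" if "z permutes {1..n}" for z
    using bruhat_le_cobigrassmannian_iff[of "n\<^sub>0 - 1" "n\<^sub>1 + 1" "n\<^sub>2 + 1" "n\<^sub>3 - 1" n z]
      that assms(3-9)
    by auto
  have corner: "rank_NW w p q = int n\<^sub>0"
    using le_c[OF w] le_c1[OF w] assms(11,12) by simp
  have Lambda: "z \<in> Lambda n w c\<^sub>1 \<longleftrightarrow> bruhat_le n z w \<and> rank_NW z p q < rank_NW w p q" for z
    using le_c1[of z] unfolding Lambda_def corner by (auto simp: bruhat_le_def)
  have mem: "tau n p q w P Q \<in> Lambda n w c\<^sub>1"
    if PQ: "P \<in> boundary_NO n p q w" "Q \<in> boundary_SE n p q w" for P Q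
  proof -
    obtain a b where PQ_eq: "P = (a, w a)" "Q = (b, w b)" and "tau_data n p q w a b"
      using boundary_tau_data[OF w PQ] .
    then interpret tau_data n p q w a b
      by simp
    show ?thesis
      unfolding Lambda PQ_eq using tau_le rank_NW_tau_corner by simp
  qed
  show ?thesis
  proof (intro equalityI subsetI)
    fix t assume "t \<in> {tau n p q w P Q | P Q. P \<in> boundary_NO n p q w \<and> Q \<in> boundary_SE n p q w}"
    then obtain P Q where PQ: "P \<in> boundary_NO n p q w" "Q \<in> boundary_SE n p q w"
      and t: "t = tau n p q w P Q"
      by blast
    \<comment> \<open>An element of \<open>Lambda\<close> above \<open>t\<close> lies below some
      \<open>tau\<close>, whose pair of points must be that of \<open>t\<close>; antisymmetry then
      gives equality.\<close>
    have "z = t" if z: "z \<in> Lambda n w c\<^sub>1" and tz: "bruhat_le n t z" for z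
    proof -
      obtain P' Q' where PQ': "P' \<in> boundary_NO n p q w" "Q' \<in> boundary_SE n p q w"
        and z': "bruhat_le n z (tau n p q w P' Q')"
        using ex_tau_above[OF w] z unfolding Lambda by blast
      have "P = P' \<and> Q = Q'"
        using tau_le_tau_imp_eq[OF w PQ PQ'] bruhat_le_trans[OF tz z'] by (simp add: t)
      then show ?thesis
        using z' tz bruhat_le_antisym by (simp add: t)
    qed
    then show "t \<in> bruhat_maximal n (Lambda n w c\<^sub>1)"
      using mem[OF PQ] by (simp add: bruhat_maximal_def t)
  next
    fix z assume z: "z \<in> bruhat_maximal n (Lambda n w c\<^sub>1)"
    then have "bruhat_le n z w" "rank_NW z p q < rank_NW w p q"
      by (auto simp: bruhat_maximal_def Lambda)
    then obtain P Q where PQ: "P \<in> boundary_NO n p q w" "Q \<in> boundary_SE n p q w"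
      "bruhat_le n z (tau n p q w P Q)"
      using ex_tau_above[OF w] by blast
    then have "z = tau n p q w P Q"
      using z mem[OF PQ(1,2)] by (auto simp: bruhat_maximal_def)
    then show "z \<in> {tau n p q w P Q | P Q. P \<in> boundary_NO n p q w \<and> Q \<in> boundary_SE n p q w}"
      using PQ by blast
  qed
qed

end
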